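(* Let $d\in\mathbb{N}$ and let $\varphi\colon(0,1]\to[0,d]$ be a function. Then there exists a non-empty set $F\subset\mathbb{R}^d$ such that $(1-\theta)\underline{\dim}^{\theta}_{\mathrm{L}}F=\varphi(\theta)$ for all $\theta\in(0,1]$ if and only if $\varphi(1)=0$, the function $\theta\mapsto\varphi(\theta)/(1-\theta)$ is decreasing on $(0,1)$, and $$\varphi(\lambda\theta)-\theta\varphi(\lambda)\leq(1-\theta)d$$ for all $\lambda,\theta\in(0,1]$.
   Context: For a metric space $X$ (subsets of $\mathbb{R}^d$ carry the Euclidean metric), $B(x,r)$ denotes the closed ball in $X$, and $N_r(E)$ the least number of closed balls of radius $r$ required to cover $E\subset X$. For $0<\theta<1$ the monotone lower spectrum is $$\underline{\dim}^{\theta}_{\mathrm{L}}X=\sup\Bigl\{s\geq0:\exists C>0\ \forall\,0<r\leq r^\theta\leq R<1,\ \inf_{x\in X}N_r(B(x,R))\geq C\Bigl(\frac{R}{r}\Bigr)^s\Bigr\}.$$ For $\theta=1$ the expression $(1-\theta)\underline{\dim}^{\theta}_{\mathrm{L}}F$ is defined to be $0$. "Decreasing" means non-increasing. *)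

theory Defs
  imports "HOL-Analysis.Analysis"
begin

text \<open>
  A subset \<open>X\<close> of a metric space type is regarded as a metric space in its own right, with the
  restricted distance: closed balls of \<open>X\<close> have their centres in \<open>X\<close> and are subsets of \<open>X\<close>.
\<close>

definition closed_ball_in :: "'a::metric_space set \<Rightarrow> 'a \<Rightarrow> real \<Rightarrow> 'a set" where
  "closed_ball_in X x r = X \<inter> cball x r"

text \<open>The value is \<open>\<infinity>\<close> if \<open>E\<close> has no finite cover by such balls.\<close>

definition covering_number :: "'a::metric_space set \<Rightarrow> real \<Rightarrow> 'a set \<Rightarrow> enat" where
  "covering_number X r E =
     (INF \<B>\<in>{\<B>. finite \<B> \<and> \<B> \<subseteq> (\<lambda>x. closed_ball_in X x r) ` X \<and> E \<subseteq> \<Union>\<B>}. enat (card \<B>))"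

definition lower_spectrum :: "real \<Rightarrow> 'a::metric_space set \<Rightarrow> ereal" where
  "lower_spectrum \<theta> X =
     (SUP s\<in>{s::real. 0 \<le> s \<and> (\<exists>C>0. \<forall>r R. 0 < r \<and> r \<le> r powr \<theta> \<and> r powr \<theta> \<le> R \<and> R < 1 \<longrightarrow>
         ereal (C * (R / r) powr s)
           \<le> ereal_of_enat (INF x\<in>X. covering_number X r (closed_ball_in X x R)))}.
      ereal s)"

text \<open>The quantity \<open>(1 - \<theta>) dim\<close>, with its value at \<open>\<theta> = 1\<close> fixed to be \<open>0\<close> by convention.\<close>

definition scaled_lower_spectrum :: "real \<Rightarrow> 'a::metric_space set \<Rightarrow> ereal" where
  "scaled_lower_spectrum \<theta> X = (if \<theta> = 1 then 0 else ereal (1 - \<theta>) * lower_spectrum \<theta> X)"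

end

theory Submission
  imports Defs
begin

text \<open>
  Write \<open>r = 2 powr - u\<close> and \<open>R = 2 powr - v\<close>, so that the admissible pairs of scales are those with
  \<open>0 < v \<le> \<theta> * u\<close>, and let \<open>n\<close> be the dimension of the space.

  \<^bold>\<open>Necessity.\<close> A smaller \<open>\<theta>\<close> admits fewer pairs of scales, hence \<open>\<phi> \<theta> / (1 - \<theta>)\<close> is decreasing. For the
  growth condition, a cover at resolution \<open>r\<close> is refined to one at resolution \<open>r powr (1 / \<theta>)\<close>; since
  a ball of \<open>\<real>\<^sup>n\<close> of radius \<open>R\<close> needs at most a multiple of \<open>(R / r) ^ n\<close> balls of radius \<open>r\<close>, an exponent
  valid for \<open>l * \<theta>\<close> yields one for \<open>l\<close> (\<open>covering_exponent_trade\<close>).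

  \<^bold>\<open>Sufficiency.\<close> For each \<open>w \<ge> 1\<close> let \<open>q\<^sub>w u = u * \<phi> (w / u)\<close> for \<open>u \<ge> w\<close>. The two conditions on \<open>\<phi>\<close> say
  just what is needed to build a set of diameter at most \<open>2 powr - w\<close> consisting of about \<open>2 powr q\<^sub>w u\<close> pieces of
  each size \<open>2 powr - u\<close>: the function \<open>q\<^sub>w\<close> vanishes at \<open>w\<close>, increases (\<open>entropy_mono\<close>), and has slope at
  most \<open>n\<close> (\<open>entropy_lipschitz\<close>). So such a cluster arises by declaring some binary digits free and the
  others zero. Monotonicity of \<open>\<phi> \<theta> / (1 - \<theta>)\<close> also gives \<open>q\<^sub>w u - q\<^sub>w v \<ge> q\<^sub>v u\<close>
  (\<open>entropy_superadditive\<close>), which means that the cluster is thick enough for the prescribed spectrum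
  near each of its points and at all smaller scales. On the other hand, the whole cluster, viewed at
  \<open>u = w / \<theta>\<close>, has no more than about \<open>2 powr (u * \<phi> \<theta>)\<close> pieces, which is the value prescribed at \<open>\<theta>\<close>;
  as \<open>w\<close> tends to infinity this bounds the spectrum from above, for all \<open>\<theta>\<close> simultaneously.

  At scales above its diameter a cluster is too thin, so the clusters are placed near the corner of
  an orthant, at a distance of about \<open>2 powr - w\<close>. A ball of larger radius
  then contains a good part of a ball of the orthant and has full exponent \<open>n\<close>, whereas a
  slightly smaller ball about a point of the cluster does not meet anything but the cluster. The resulting set
  \<open>clustered_orthant \<phi>\<close> therefore satisfies both bounds (\<open>clustered_orthant_exponent\<close> and
  \<open>clustered_orthant_exponent_le\<close>). A homogeneous set could
  not do in general: on the line, the profile \<open>max 0 (1 - 2 * \<theta>)\<close> forces some ball with \<open>v = u / 2\<close>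
  to be almost trivial at resolution \<open>u\<close>, and if all balls looked like this one, then balls with
  \<open>v = u / 4\<close> would have at most about \<open>2 powr (u / 4)\<close> pieces instead of \<open>2 powr (u / 2)\<close>.
\<close>

section \<open>Covering numbers in Euclidean space\<close>

text \<open>
  The infimum over the centres is attained because \<^typ>\<open>enat\<close> is well-ordered, so a uniform lower
  bound can be checked one centre at a time; for empty \<open>X\<close> both sides hold.
\<close>

lemma real_le_INF_enat_iff:
  fixes f :: "'a \<Rightarrow> enat"
  shows "ereal c \<le> ereal_of_enat (INF x\<in>X. f x) \<longleftrightarrow> (\<forall>x\<in>X. ereal c \<le> ereal_of_enat (f x))"
proof
  assume *: "ereal c \<le> ereal_of_enat (INF x\<in>X. f x)"
  show "\<forall>x\<in>X. ereal c \<le> ereal_of_enat (f x)"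
    by (metis * INF_lower ereal_of_enat_le_iff order_trans)
next
  assume *: "\<forall>x\<in>X. ereal c \<le> ereal_of_enat (f x)"
  show "ereal c \<le> ereal_of_enat (INF x\<in>X. f x)"
  proof (cases "X = {}")
    case True
    then show ?thesis by (simp add: top_enat_def)
  next
    case False
    then have "(INF x\<in>X. f x) \<in> f ` X"
      using wellorder_InfI[of _ "f ` X"] by auto
    then show ?thesis using * by auto
  qed
qed

lemma covering_number_le_card:
  assumes "finite P" "P \<subseteq> X" "E \<subseteq> X" "\<And>y. y \<in> E \<Longrightarrow> \<exists>p\<in>P. dist p y \<le> r"
  shows "covering_number X r E \<le> enat (card P)"
proof -
  have "covering_number X r E \<le> enat (card ((\<lambda>x. closed_ball_in X x r) ` P))"
    unfolding covering_number_def
    by (rule INF_lower) (use assms in \<open>force simp: closed_ball_in_def\<close>)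
  also have "\<dots> \<le> enat (card P)"
    using assms(1) by (simp add: card_image_le)
  finally show ?thesis .
qed

text \<open>
  The balls must be centred in \<open>X\<close>, so a partition of \<open>E\<close> into cells of diameter at most \<open>r\<close> is
  turned into a cover by choosing a point of \<open>E\<close> in each non-empty cell.
\<close>

lemma covering_number_le_card_image:
  assumes "E \<subseteq> X" "finite (g ` E)" "\<And>y z. y \<in> E \<Longrightarrow> z \<in> E \<Longrightarrow> g y = g z \<Longrightarrow> dist y z \<le> r"
  shows "covering_number X r E \<le> enat (card (g ` E))"
proof -
  define h where "h = inv_into E g"
  have "covering_number X r E \<le> enat (card (h ` g ` E))"
  proof (rule covering_number_le_card)
    show "h ` g ` E \<subseteq> X" using assms(1) by (auto simp: h_def inv_into_into)
    show "\<exists>p\<in>h ` g ` E. dist p y \<le> r" if "y \<in> E" for y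
      using that assms(3)[of "h (g y)" y] by (auto simp: h_def inv_into_into f_inv_into_f)
  qed (use assms in auto)
  also have "\<dots> \<le> enat (card (g ` E))"
    using assms(2) by (simp add: card_image_le)
  finally show ?thesis .
qed

text \<open>
  A ball of radius \<open>r\<close> has diameter at most \<open>2 * r\<close>, hence contains at most one point of \<open>P\<close>.
\<close>

lemma card_le_covering_number:
  assumes "P \<subseteq> E" "\<And>y z. y \<in> P \<Longrightarrow> z \<in> P \<Longrightarrow> y \<noteq> z \<Longrightarrow> 2 * r < dist y z"
  shows "enat (card P) \<le> covering_number X r E"
  unfolding covering_number_def
proof (rule INF_greatest, clarsimp)
  fix \<B> assume \<B>: "finite \<B>" "\<B> \<subseteq> (\<lambda>x. closed_ball_in X x r) ` X" "E \<subseteq> \<Union>\<B>"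
  have "\<forall>y\<in>P. \<exists>B\<in>\<B>. y \<in> B" using \<B>(3) assms(1) by blast
  then obtain b where b: "\<And>y. y \<in> P \<Longrightarrow> b y \<in> \<B> \<and> y \<in> b y"
    by metis
  have "inj_on b P"
  proof (rule inj_onI, rule ccontr)
    fix y z assume yz: "y \<in> P" "z \<in> P" "b y = b z" "y \<noteq> z"
    obtain x where "b y = closed_ball_in X x r" using b[OF yz(1)] \<B>(2) by auto
    then have "dist x y \<le> r" "dist x z \<le> r"
      using b[OF yz(1)] b[OF yz(2)] yz(3) by (auto simp: closed_ball_in_def)
    then show False using assms(2)[OF yz(1,2,4)] dist_triangle3[of y z x] by linarith
  qed
  then show "card P \<le> card \<B>"
    using b \<B>(1) by (metis card_inj_on_le image_subsetI)
qed

lemma covering_number_attained: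
  assumes "covering_number X r E = enat m"
  obtains P where "finite P" "P \<subseteq> X" "card P \<le> m" "E \<subseteq> (\<Union>p\<in>P. closed_ball_in X p r)"
proof -
  let ?S = "{\<B>. finite \<B> \<and> \<B> \<subseteq> (\<lambda>x. closed_ball_in X x r) ` X \<and> E \<subseteq> \<Union>\<B>}"
  have "?S \<noteq> {}"
    using assms unfolding covering_number_def by (metis (no_types, lifting) INF_empty enat.distinct(1) top_enat_def)
  then have "(INF \<B>\<in>?S. enat (card \<B>)) \<in> (\<lambda>\<B>. enat (card \<B>)) ` ?S"
    using wellorder_InfI[of _ "(\<lambda>\<B>. enat (card \<B>)) ` ?S"] by blast
  then obtain \<B> where \<B>: "\<B> \<in> ?S" "card \<B> = m"
    using assms unfolding covering_number_def by auto
  then have "\<B> \<subseteq> (\<lambda>x. closed_ball_in X x r) ` X" by simp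
  then obtain P where P: "P \<subseteq> X" "inj_on (\<lambda>x. closed_ball_in X x r) P" "\<B> = (\<lambda>x. closed_ball_in X x r) ` P"
    by (meson subset_image_inj)
  then have "finite P" "card P = m"
    using \<B> by (auto simp: finite_image_iff card_image)
  with P \<B> show ?thesis by (intro that[of P]) auto
qed

lemma covering_number_mult:
  assumes "covering_number X r E = enat m"
    and "\<And>y. y \<in> X \<Longrightarrow> covering_number X \<rho> (closed_ball_in X y r) \<le> enat K"
    and "E \<subseteq> X"
  shows "covering_number X \<rho> E \<le> enat (m * K)"
proof -
  obtain P where P: "finite P" "P \<subseteq> X" "card P \<le> m" "E \<subseteq> (\<Union>p\<in>P. closed_ball_in X p r)"
    using covering_number_attained[OF assms(1)] .
  have "\<exists>Q. finite Q \<and> Q \<subseteq> X \<and> card Q \<le> K \<and> closed_ball_in X p r \<subseteq> (\<Union>q\<in>Q. closed_ball_in X q \<rho>)"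
    if "p \<in> P" for p
  proof -
    obtain k where k: "covering_number X \<rho> (closed_ball_in X p r) = enat k" "k \<le> K"
    proof -
      have le: "covering_number X \<rho> (closed_ball_in X p r) \<le> enat K"
        using assms(2) \<open>p \<in> P\<close> P(2) by auto
      then obtain k where k: "covering_number X \<rho> (closed_ball_in X p r) = enat k"
        by (auto dest: enat_ile)
      with le show ?thesis by (intro that[of k]) simp_all
    qed
    obtain Q where "finite Q" "Q \<subseteq> X" "card Q \<le> k"
      "closed_ball_in X p r \<subseteq> (\<Union>q\<in>Q. closed_ball_in X q \<rho>)"
      using covering_number_attained[OF k(1)] .
    with k(2) show ?thesis by (intro exI[of _ Q]) simp
  qed
  then obtain Q where Q: "\<And>p. p \<in> P \<Longrightarrow> finite (Q p) \<and> Q p \<subseteq> X \<and> card (Q p) \<le> K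
      \<and> closed_ball_in X p r \<subseteq> (\<Union>q\<in>Q p. closed_ball_in X q \<rho>)"
    by metis
  have "covering_number X \<rho> E \<le> enat (card (\<Union>p\<in>P. Q p))"
  proof (rule covering_number_le_card)
    fix y assume "y \<in> E"
    then obtain p where p: "p \<in> P" "y \<in> closed_ball_in X p r" using P(4) by auto
    with Q[OF p(1)] obtain q where "q \<in> Q p" "y \<in> closed_ball_in X q \<rho>" by blast
    with p(1) show "\<exists>q\<in>\<Union>p\<in>P. Q p. dist q y \<le> \<rho>" by (auto simp: closed_ball_in_def)
  next
    show "finite (\<Union>p\<in>P. Q p)" using P(1) Q by blast
    show "(\<Union>p\<in>P. Q p) \<subseteq> X" using Q by blast
    show "E \<subseteq> X" by (rule assms)
  qed
  moreover have "card (\<Union>p\<in>P. Q p) \<le> m * K"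
  proof -
    have "card (\<Union>p\<in>P. Q p) \<le> (\<Sum>p\<in>P. card (Q p))"
      using P(1) by (rule card_UN_le)
    also have "\<dots> \<le> of_nat (card P) * K"
      by (rule sum_bounded_above) (use Q in blast)
    also have "\<dots> \<le> m * K" using P(3) by simp
    finally show ?thesis .
  qed
  ultimately show ?thesis by (meson enat_ord_simps(1) order_trans)
qed

lemma dist_le_card_mult:
  fixes x y :: "real ^ 'n"
  assumes "\<And>i. \<bar>x $ i - y $ i\<bar> \<le> e"
  shows "dist x y \<le> real CARD('n) * e"
proof -
  have "dist x y \<le> (\<Sum>i\<in>UNIV. \<bar>(x - y) $ i\<bar>)"
    unfolding dist_norm by (rule norm_le_l1_cart)
  also have "\<dots> \<le> of_nat (card (UNIV :: 'n set)) * e"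
    by (rule sum_bounded_above) (use assms in auto)
  finally show ?thesis by simp
qed

text \<open>
  Cut the ball by the grid of mesh \<open>r / n\<close>: each cell has diameter at most \<open>r\<close>, and each coordinate
  meets at most \<open>2 * n * (R / r) + 2\<close> intervals.
\<close>

lemma covering_number_ball_le:
  fixes X :: "(real ^ 'n) set"
  assumes "0 < r" "r \<le> R"
  obtains m where "covering_number X r (closed_ball_in X x R) \<le> enat m"
    "real m \<le> ((2 * real CARD('n) + 2) * (R / r)) ^ CARD('n)"
proof -
  let ?n = "real CARD('n)" and ?E = "closed_ball_in X x R"
  have n: "?n \<ge> 1" by (simp add: Suc_leI)
  define \<delta> where "\<delta> = r / ?n"
  have \<delta>: "\<delta> > 0" "?n * \<delta> = r" using assms n by (auto simp: \<delta>_def)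
  define g :: "real ^ 'n \<Rightarrow> 'n \<Rightarrow> int" where "g y = (\<lambda>i. \<lfloor>y $ i / \<delta>\<rfloor>)" for y
  define J where "J i = {\<lfloor>(x $ i - R) / \<delta>\<rfloor>..\<lfloor>(x $ i + R) / \<delta>\<rfloor>}" for i
  have sub: "g ` ?E \<subseteq> PiE UNIV J"
  proof (clarsimp simp: PiE_UNIV_domain Pi_iff)
    fix y i assume "y \<in> ?E"
    then have "\<bar>x $ i - y $ i\<bar> \<le> R"
      using component_le_norm_cart[of "x - y" i] by (auto simp: closed_ball_in_def dist_norm)
    then show "g y i \<in> J i"
      using \<delta>(1) by (auto simp: g_def J_def intro!: floor_mono divide_right_mono)
  qed
  have fin: "finite (PiE UNIV J)" by (intro finite_PiE) (auto simp: J_def)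
  have "covering_number X r ?E \<le> enat (card (g ` ?E))"
  proof (rule covering_number_le_card_image)
    show "finite (g ` ?E)" using sub fin by (rule finite_subset)
    fix y z assume "g y = g z"
    then have eq: "\<lfloor>y $ i / \<delta>\<rfloor> = \<lfloor>z $ i / \<delta>\<rfloor>" for i by (auto simp: g_def fun_eq_iff)
    have "\<bar>y $ i / \<delta> - z $ i / \<delta>\<bar> \<le> 1" for i
      using eq[of i] by linarith
    then have "\<bar>y $ i - z $ i\<bar> / \<delta> \<le> 1" for i
      using \<delta>(1) by (simp add: diff_divide_distrib[symmetric])
    then have "\<bar>y $ i - z $ i\<bar> \<le> \<delta>" for i
      using \<delta>(1) by simp
    then show "dist y z \<le> r" using dist_le_card_mult[of y z \<delta>] \<delta>(2) by simp
  qed (auto simp: closed_ball_in_def)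
  moreover have "real (card (g ` ?E)) \<le> ((2 * ?n + 2) * (R / r)) ^ CARD('n)"
  proof -
    have J: "real (card (J i)) \<le> (2 * ?n + 2) * (R / r)" for i
    proof -
      have "(x $ i - R) / \<delta> \<le> (x $ i + R) / \<delta>"
        using assms \<delta>(1) by (intro divide_right_mono) auto
      then have "\<lfloor>(x $ i - R) / \<delta>\<rfloor> \<le> \<lfloor>(x $ i + R) / \<delta>\<rfloor>" by (rule floor_mono)
      then have "real (card (J i)) = of_int (\<lfloor>(x $ i + R) / \<delta>\<rfloor> - \<lfloor>(x $ i - R) / \<delta>\<rfloor> + 1)"
        by (simp add: J_def)
      also have "\<dots> \<le> (x $ i + R) / \<delta> - (x $ i - R) / \<delta> + 2" by linarith
      also have "\<dots> = 2 * ?n * (R / r) + 2"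
        using \<delta> n by (simp add: \<delta>_def field_simps)
      also have "\<dots> \<le> (2 * ?n + 2) * (R / r)"
        using assms by (simp add: field_simps)
      finally show ?thesis .
    qed
    have "real (card (g ` ?E)) \<le> real (card (PiE UNIV J))"
      using card_mono[OF fin sub] by simp
    also have "\<dots> = (\<Prod>i\<in>UNIV. real (card (J i)))" by (simp add: card_PiE)
    also have "\<dots> \<le> (\<Prod>i\<in>(UNIV :: 'n set). (2 * ?n + 2) * (R / r))"
      by (rule prod_mono) (use J in auto)
    finally show ?thesis by simp
  qed
  ultimately show ?thesis by (rule that)
qed

section \<open>Admissible profiles and their entropy\<close>

text \<open>
  In terms of \<open>\<phi>\<close>, the growth condition says that \<open>(d - \<phi> \<theta>) / \<theta>\<close> is decreasing.
\<close>

locale spectrum_profile =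
  fixes \<phi> :: "real \<Rightarrow> real" and d :: real
  assumes nonneg: "\<theta> \<in> {0<..1} \<Longrightarrow> 0 \<le> \<phi> \<theta>"
    and at_1: "\<phi> 1 = 0"
    and antimono: "antimono_on {0<..<1} (\<lambda>\<theta>. \<phi> \<theta> / (1 - \<theta>))"
    and growth: "l \<in> {0<..1} \<Longrightarrow> \<theta> \<in> {0<..1} \<Longrightarrow> \<phi> (l * \<theta>) - \<theta> * \<phi> l \<le> (1 - \<theta>) * d"
begin

text \<open>
  The binary logarithm of the number of pieces of size \<open>2 powr - u\<close> in a set of diameter at most
  \<open>2 powr - w\<close> that is as thin as the profile permits at every scale \<open>u\<close> at once, for \<open>0 < w \<le> u\<close>.
\<close>

definition entropy :: "real \<Rightarrow> real \<Rightarrow> real" where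
  "entropy w u = u * \<phi> (w / u)"

lemma entropy_self: "w > 0 \<Longrightarrow> entropy w w = 0"
  by (simp add: entropy_def at_1)

lemma entropy_nonneg: "0 < w \<Longrightarrow> w \<le> u \<Longrightarrow> 0 \<le> entropy w u"
  unfolding entropy_def by (intro mult_nonneg_nonneg nonneg) auto

lemma profile_le: "0 < \<theta> \<Longrightarrow> \<theta> \<le> 1 \<Longrightarrow> \<phi> \<theta> \<le> (1 - \<theta>) * d"
  using growth[of 1 \<theta>] at_1 by simp

lemma exponent_le: 
  assumes "0 < \<theta>" "\<theta> < 1"
  shows "\<phi> \<theta> / (1 - \<theta>) \<le> d"
  using profile_le[of \<theta>] assms by (simp add: field_simps)

lemma exponent_antimono:
  "0 < a \<Longrightarrow> a \<le> b \<Longrightarrow> b < 1 \<Longrightarrow> \<phi> b / (1 - b) \<le> \<phi> a / (1 - a)"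
  using monotone_onD[OF antimono, of a b] by simp

lemma entropy_eq: "0 < w \<Longrightarrow> w < u \<Longrightarrow> entropy w u = (u - w) * (\<phi> (w / u) / (1 - w / u))"
  by (simp add: entropy_def field_simps)

text \<open>
  Since the exponents \<open>\<phi> \<theta> / (1 - \<theta>)\<close> decrease in \<open>\<theta>\<close>, the value at \<open>v / u \<le> \<theta>\<close> is at least the
  one at \<open>\<theta>\<close>.
\<close>

lemma entropy_ge_exponent:
  assumes "0 < \<theta>" "\<theta> < 1" "0 < v" "v \<le> \<theta> * u"
  shows "\<phi> \<theta> / (1 - \<theta>) * (u - v) \<le> entropy v u"
proof -
  have "0 < \<theta> * u" using assms by linarith
  then have u: "0 < u" using assms by (simp add: zero_less_mult_iff)
  have "v / u \<le> \<theta>" using u assms by (simp add: field_simps)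
  then have "v / u < 1" using assms by linarith
  then have vu: "v < u" using u by simp
  have "\<phi> \<theta> / (1 - \<theta>) \<le> \<phi> (v / u) / (1 - v / u)"
    using assms u \<open>v / u \<le> \<theta>\<close> by (intro exponent_antimono) auto
  then have "(u - v) * (\<phi> \<theta> / (1 - \<theta>)) \<le> (u - v) * (\<phi> (v / u) / (1 - v / u))"
    using vu by (intro mult_left_mono) auto
  also have "\<dots> = entropy v u" using entropy_eq[OF assms(3) vu] by simp
  finally show ?thesis by (simp only: mult.commute)
qed

text \<open>
  Both \<open>w / v\<close> and \<open>v / u\<close> are at least \<open>w / u\<close>, so the average rate of \<open>entropy w\<close> over \<open>[w, u]\<close>
  dominates its rate over \<open>[w, v]\<close> and the rate of \<open>entropy v\<close> over \<open>[v, u]\<close>. Consequently a set that starts at scale \<open>w\<close> with this entropy is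
  thick enough around each point at all intermediate scales \<open>v\<close>, and not only at its initial scale.
\<close>

lemma entropy_superadditive:
  assumes "0 < w" "w \<le> v" "v \<le> u"
  shows "entropy w v + entropy v u \<le> entropy w u"
proof (cases "w = v \<or> v = u")
  case True
  then show ?thesis using assms by (auto simp: entropy_self)
next
  case False
  then have *: "w < v" "v < u" using assms by auto
  let ?D = "\<lambda>t. \<phi> t / (1 - t)"
  have D: "?D (w / v) \<le> ?D (w / u)" "?D (v / u) \<le> ?D (w / u)"
    using assms * by (auto intro!: exponent_antimono divide_left_mono divide_right_mono)
  have "entropy w v + entropy v u = (v - w) * ?D (w / v) + (u - v) * ?D (v / u)"
    using assms * by (simp add: entropy_eq)
  also have "\<dots> \<le> (v - w) * ?D (w / u) + (u - v) * ?D (w / u)"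
    using D * by (intro add_mono mult_left_mono) auto
  also have "\<dots> = (u - w) * ?D (w / u)" by (simp only: left_diff_distrib)
  also have "\<dots> = entropy w u" using assms * by (simp add: entropy_eq)
  finally show ?thesis .
qed

lemma entropy_mono:
  assumes "0 < w" "w \<le> v" "v \<le> u"
  shows "entropy w v \<le> entropy w u"
  using entropy_superadditive[OF assms] entropy_nonneg[of v u] assms by linarith

text \<open>
  This is exactly the growth condition, and it is what makes the entropy realisable in
  dimension \<open>d\<close>.
\<close>

lemma entropy_lipschitz:
  assumes "0 < w" "w \<le> v" "v \<le> u"
  shows "entropy w u \<le> entropy w v + d * (u - v)"
proof -
  have "\<phi> ((w / v) * (v / u)) \<le> (v / u) * \<phi> (w / v) + (1 - v / u) * d"
    using growth[of "w / v" "v / u"] assms by simp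
  then have "u * \<phi> (w / u) \<le> u * ((v / u) * \<phi> (w / v) + (1 - v / u) * d)"
    using assms by (intro mult_left_mono) auto
  also have "\<dots> = v * \<phi> (w / v) + d * (u - v)" using assms by (simp add: field_simps)
  finally show ?thesis by (simp add: entropy_def)
qed

end

section \<open>Sets with prescribed binary digits\<close>

text \<open>
  A function with increments in \<open>[0, 1]\<close> is followed up to an error less than \<open>1\<close> by the counting
  function of a set of naturals, namely of the places where its integer part jumps.
\<close>

definition floor_jumps :: "(nat \<Rightarrow> real) \<Rightarrow> nat \<Rightarrow> nat set" where
  "floor_jumps g N = {k. N < k \<and> \<lfloor>g k\<rfloor> \<noteq> \<lfloor>g (k - 1)\<rfloor>}"

lemma card_floor_jumps:
  assumes g: "\<And>k. N \<le> k \<Longrightarrow> g k \<le> g (Suc k) \<and> g (Suc k) \<le> g k + 1" and "N \<le> j" "j \<le> k"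
  shows "int (card (floor_jumps g N \<inter> {j<..k})) = \<lfloor>g k\<rfloor> - \<lfloor>g j\<rfloor>"
  using \<open>j \<le> k\<close>
proof (induction k rule: dec_induct)
  case (step k)
  have le: "\<lfloor>g k\<rfloor> \<le> \<lfloor>g (Suc k)\<rfloor>" "\<lfloor>g (Suc k)\<rfloor> \<le> \<lfloor>g k\<rfloor> + 1"
    using g[of k] step \<open>N \<le> j\<close> by linarith+
  have "{j<..Suc k} = insert (Suc k) {j<..k}" using step by auto
  then have "floor_jumps g N \<inter> {j<..Suc k} =
    (if \<lfloor>g (Suc k)\<rfloor> \<noteq> \<lfloor>g k\<rfloor> then insert (Suc k) (floor_jumps g N \<inter> {j<..k}) else floor_jumps g N \<inter> {j<..k})"
    using step \<open>N \<le> j\<close> by (auto simp: floor_jumps_def)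
  then show ?case using step.IH le by auto
qed simp

definition dyadic_sum :: "nat set \<Rightarrow> real" where
  "dyadic_sum B = (\<Sum>m\<in>B. (1/2) ^ m)"

lemma dyadic_sum_nonneg: "0 \<le> dyadic_sum B"
  unfolding dyadic_sum_def by (intro sum_nonneg) simp

lemma dyadic_sum_Un: "finite A \<Longrightarrow> finite B \<Longrightarrow> A \<inter> B = {} \<Longrightarrow> dyadic_sum (A \<union> B) = dyadic_sum A + dyadic_sum B"
  unfolding dyadic_sum_def by (rule sum.union_disjoint)

lemma dyadic_sum_le:
  assumes "finite B" "B \<subseteq> {j<..}"
  shows "dyadic_sum B \<le> (1/2) ^ j"
proof -
  obtain k where k: "B \<subseteq> {j<..k}" "j \<le> k"
  proof
    show "B \<subseteq> {j<..max j (Max B)}" using assms by (auto simp: le_max_iff_disj)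
  qed simp
  have "dyadic_sum {j<..k} = (1/2) ^ j - (1/2) ^ k"
    using k(2)
  proof (induction k rule: dec_induct)
    case (step k)
    have "{j<..Suc k} = insert (Suc k) {j<..k}" using step by auto
    then show ?case using step.IH by (simp add: dyadic_sum_def)
  qed (simp add: dyadic_sum_def)
  moreover have "dyadic_sum B \<le> dyadic_sum {j<..k}"
    unfolding dyadic_sum_def using k by (intro sum_mono2) auto
  moreover have "0 \<le> (1/2 :: real) ^ k" by simp
  ultimately show ?thesis by linarith
qed

text \<open>
  Multiplied by \<open>2 ^ k\<close>, the two sums become distinct integers, by uniqueness of binary expansions.
\<close>

lemma dyadic_sum_separated:
  assumes "B \<subseteq> {..k}" "B' \<subseteq> {..k}" "B \<noteq> B'"
  shows "(1/2) ^ k \<le> \<bar>dyadic_sum B - dyadic_sum B'\<bar>"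
proof -
  let ?e = "\<lambda>B. set_encode ((-) k ` B)"
  have inj: "inj_on ((-) k) {..k}" by (auto simp: inj_on_def)
  have eq: "dyadic_sum B * 2 ^ k = real (?e B)" if "B \<subseteq> {..k}" for B
  proof -
    have "?e B = (\<Sum>m\<in>B. 2 ^ (k - m))"
      unfolding set_encode_def using inj_on_subset[OF inj that] by (simp add: sum.reindex)
    moreover have "dyadic_sum B * 2 ^ k = (\<Sum>m\<in>B. 2 ^ (k - m))"
      unfolding dyadic_sum_def sum_distrib_right
      by (rule sum.cong) (use that in \<open>auto simp: power_diff power_divide\<close>)
    ultimately show ?thesis by simp
  qed
  have "(-) k ` B \<noteq> (-) k ` B'" using inj_on_image_eq_iff[OF inj assms(1,2)] assms(3) by simp
  then have "?e B \<noteq> ?e B'"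
    using assms finite_subset[OF assms(1)] finite_subset[OF assms(2)] by (simp add: set_encode_eq)
  then have "1 \<le> \<bar>real (?e B) - real (?e B')\<bar>" by linarith
  also have "\<dots> = \<bar>dyadic_sum B - dyadic_sum B'\<bar> * 2 ^ k"
    unfolding eq[OF assms(1), symmetric] eq[OF assms(2), symmetric] left_diff_distrib[symmetric]
    by (simp add: abs_mult)
  finally show ?thesis by (simp add: power_divide field_simps)
qed

definition dyadic_shift :: "real ^ 'n \<Rightarrow> ('n \<Rightarrow> nat set) \<Rightarrow> real ^ 'n" where
  "dyadic_shift p B = (\<chi> i. p $ i + dyadic_sum (B i))"

lemma dyadic_shift_nth [simp]: "dyadic_shift p B $ i = p $ i + dyadic_sum (B i)"
  by (simp add: dyadic_shift_def)

lemma card_PiE_Pow: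
  "finite A \<Longrightarrow> card (PiE (UNIV :: 'n::finite set) (\<lambda>_. Pow A)) = 2 ^ (CARD('n) * card A)"
  by (simp add: card_PiE card_Pow power_mult[symmetric] mult.commute)

text \<open>
  Freely chosen binary digits at the places in \<open>A\<close> produce \<open>2 ^ card A\<close> values in each coordinate.
  They stay close to \<open>p\<close> because all places are beyond \<open>j\<close>, and they are separated because none is
  beyond \<open>k\<close>.
\<close>

lemma covering_number_ge_dyadic:
  fixes X :: "(real ^ 'n) set"
  assumes A: "A \<subseteq> {j<..k}" and X: "\<And>B. (\<And>i. B i \<subseteq> A) \<Longrightarrow> dyadic_shift p B \<in> X"
    and p: "dist x p \<le> R / 2" and j: "real CARD('n) * (1/2) ^ j \<le> R / 2" and k: "2 * r < (1/2) ^ k"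
  shows "enat (2 ^ (CARD('n) * card A)) \<le> covering_number X r (closed_ball_in X x R)"
proof -
  let ?\<B> = "PiE UNIV (\<lambda>_::'n. Pow A)"
  have finA: "finite A" using A by (rule finite_subset) simp
  have coord: "\<exists>i. (1/2) ^ k \<le> \<bar>dyadic_shift p B $ i - dyadic_shift p B' $ i\<bar>"
    if "B \<in> ?\<B>" "B' \<in> ?\<B>" "B \<noteq> B'" for B B'
  proof -
    obtain i where i: "B i \<noteq> B' i" using \<open>B \<noteq> B'\<close> by (auto simp: fun_eq_iff)
    have "B i \<subseteq> A" "B' i \<subseteq> A" using that by (auto simp: PiE_UNIV_domain)
    then have "B i \<subseteq> {..k}" "B' i \<subseteq> {..k}" using A by auto
    then have "(1/2) ^ k \<le> \<bar>dyadic_sum (B i) - dyadic_sum (B' i)\<bar>"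
      using i by (rule dyadic_sum_separated)
    then show ?thesis by (intro exI[of _ i]) simp
  qed
  have pos: "0 < (1/2 :: real) ^ k" by simp
  have inj: "inj_on (dyadic_shift p) ?\<B>"
  proof (rule inj_onI, rule ccontr)
    fix B B' assume *: "B \<in> ?\<B>" "B' \<in> ?\<B>" "dyadic_shift p B = dyadic_shift p B'" "B \<noteq> B'"
    then show False using coord[OF *(1,2,4)] pos by (auto simp: not_le simp del: dyadic_shift_nth)
  qed
  have "card (dyadic_shift p ` ?\<B>) = card ?\<B>" by (rule card_image[OF inj])
  also have "\<dots> = 2 ^ (CARD('n) * card A)" using finA by (rule card_PiE_Pow)
  finally have "enat (2 ^ (CARD('n) * card A)) = enat (card (dyadic_shift p ` ?\<B>))" by simp
  also have "\<dots> \<le> covering_number X r (closed_ball_in X x R)"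
  proof (rule card_le_covering_number)
    show "dyadic_shift p ` ?\<B> \<subseteq> closed_ball_in X x R"
    proof (rule image_subsetI)
      fix B assume B: "B \<in> ?\<B>"
      then have BA: "B i \<subseteq> A" for i by (auto simp: PiE_UNIV_domain)
      have "dist p (dyadic_shift p B) \<le> real CARD('n) * (1/2) ^ j"
      proof (rule dist_le_card_mult)
        fix i
        have "B i \<subseteq> {j<..}" "finite (B i)" using BA[of i] A finA by (auto intro: finite_subset)
        then show "\<bar>p $ i - dyadic_shift p B $ i\<bar> \<le> (1/2) ^ j"
          using dyadic_sum_le[of "B i" j] dyadic_sum_nonneg[of "B i"] by simp
      qed
      then have "dist x (dyadic_shift p B) \<le> R"
        using dist_triangle[of x "dyadic_shift p B" p] p j by linarith
      then show "dyadic_shift p B \<in> closed_ball_in X x R"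
        using X[OF BA] by (simp add: closed_ball_in_def)
    qed
    fix y z assume yz: "y \<in> dyadic_shift p ` ?\<B>" "z \<in> dyadic_shift p ` ?\<B>" "y \<noteq> z"
    then obtain B B' where "B \<in> ?\<B>" "B' \<in> ?\<B>" "y = dyadic_shift p B" "z = dyadic_shift p B'"
      by blast
    with yz(3) coord[of B B'] obtain i where "(1/2) ^ k \<le> \<bar>y $ i - z $ i\<bar>" by blast
    also have "\<dots> \<le> dist y z"
      using component_le_norm_cart[of "y - z" i] by (simp add: dist_norm)
    finally show "2 * r < dist y z" using k by linarith
  qed
  finally show ?thesis .
qed

section \<open>Necessity: the scaled spectrum is an admissible profile\<close>

text \<open>
  The exponents over which the lower spectrum is a supremum, with the infimum over the centres
  replaced by a bound at each centre.
\<close>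

definition covering_exponent :: "real \<Rightarrow> 'a::metric_space set \<Rightarrow> real \<Rightarrow> bool" where
  "covering_exponent \<theta> X s \<longleftrightarrow> 0 \<le> s \<and> (\<exists>C>0. \<forall>r R. 0 < r \<and> r \<le> r powr \<theta> \<and> r powr \<theta> \<le> R \<and> R < 1
     \<longrightarrow> (\<forall>x\<in>X. ereal (C * (R / r) powr s) \<le> ereal_of_enat (covering_number X r (closed_ball_in X x R))))"

lemma le_of_enat_bound:
  "ereal c \<le> ereal_of_enat N \<Longrightarrow> N \<le> enat m \<Longrightarrow> c \<le> real m"
  by (cases N) auto

lemma lower_spectrum_eq_SUP:
  "lower_spectrum \<theta> X = (SUP s\<in>{s. covering_exponent \<theta> X s}. ereal s)"
  unfolding lower_spectrum_def covering_exponent_def real_le_INF_enat_iff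
  by (rule refl)

lemma covering_exponent_mono:
  assumes "covering_exponent \<theta>' X s" "0 < \<theta>" "\<theta> \<le> \<theta>'" "\<theta>' < 1"
  shows "covering_exponent \<theta> X s"
proof -
  obtain C where C: "C > 0" "\<And>r R x. 0 < r \<Longrightarrow> r \<le> r powr \<theta>' \<Longrightarrow> r powr \<theta>' \<le> R \<Longrightarrow> R < 1 \<Longrightarrow> x \<in> X
     \<Longrightarrow> ereal (C * (R / r) powr s) \<le> ereal_of_enat (covering_number X r (closed_ball_in X x R))"
    using assms(1) unfolding covering_exponent_def by blast
  have "ereal (C * (R / r) powr s) \<le> ereal_of_enat (covering_number X r (closed_ball_in X x R))"
    if *: "0 < r" "r \<le> r powr \<theta>" "r powr \<theta> \<le> R" "R < 1" "x \<in> X" for r R x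
  proof -
    have r: "r < 1" using * by linarith
    have "r powr 1 \<le> r powr \<theta>'" "r powr \<theta>' \<le> r powr \<theta>"
      by (rule powr_mono'; use * r assms in simp)+
    then show ?thesis using * C(2)[of r R x] by simp
  qed
  then show ?thesis using assms(1) C(1) unfolding covering_exponent_def by blast
qed

text \<open>
  Fix \<open>R = 1/2\<close> and let \<open>r\<close> tend to \<open>0\<close>: the bound \<open>(R / r) powr s\<close> from below must not outgrow the
  bound \<open>(R / r) ^ n\<close> from above. The \<open>z\<close> in the proof is the ratio \<open>R / r\<close>.
\<close>

lemma covering_exponent_le_dim:
  fixes X :: "(real ^ 'n) set"
  assumes s: "covering_exponent \<theta> X s" and "0 < \<theta>" "\<theta> < 1" "X \<noteq> {}"
  shows "s \<le> real CARD('n)"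
proof (rule ccontr)
  let ?n = "CARD('n)"
  assume "\<not> s \<le> real ?n"
  then have sn: "s - real ?n > 0" by simp
  obtain C where C: "C > 0" "\<And>r R x. 0 < r \<Longrightarrow> r \<le> r powr \<theta> \<Longrightarrow> r powr \<theta> \<le> R \<Longrightarrow> R < 1 \<Longrightarrow> x \<in> X
     \<Longrightarrow> ereal (C * (R / r) powr s) \<le> ereal_of_enat (covering_number X r (closed_ball_in X x R))"
    using s unfolding covering_exponent_def by blast
  obtain x where x: "x \<in> X" using assms by blast
  define K where "K = (2 * real ?n + 2) ^ ?n"
  define z where "z = max (2 powr (1 / \<theta>)) ((K / C + 1) powr (1 / (s - real ?n)))"
  have z1: "z \<ge> 1" using assms by (auto simp: z_def le_max_iff_disj ge_one_powr_ge_zero)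
  define r where "r = 1 / (2 * z)"
  have r: "0 < r" "r \<le> 1/2" using z1 by (auto simp: r_def field_simps)
  have "r powr 1 \<le> r powr \<theta>" using r assms by (intro powr_mono') auto
  moreover have "r powr \<theta> \<le> 1/2"
  proof -
    have "r \<le> 1 / (2 powr (1 / \<theta>))"
      using z1 by (auto simp: r_def z_def intro!: divide_left_mono)
    then have "r powr \<theta> \<le> (1 / (2 powr (1 / \<theta>))) powr \<theta>"
      using r assms by (intro powr_mono2) auto
    also have "\<dots> = 1/2" using assms by (simp add: powr_divide powr_powr)
    finally show ?thesis .
  qed
  ultimately have 1: "ereal (C * z powr s) \<le> ereal_of_enat (covering_number X r (closed_ball_in X x (1/2)))"
    using C(2)[of r "1/2" x] r x z1 by (simp add: r_def)
  obtain m where m: "covering_number X r (closed_ball_in X x (1/2)) \<le> enat m"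
    "real m \<le> ((2 * real ?n + 2) * ((1/2) / r)) ^ ?n"
    using covering_number_ball_le[OF r] .
  have "C * z powr s \<le> m"
    using 1 m(1) by (rule le_of_enat_bound)
  also have "\<dots> \<le> ((2 * real ?n + 2) * ((1/2) / r)) ^ ?n" by (rule m)
  also have "(1/2) / r = z" using z1 by (simp add: r_def)
  also have "((2 * real ?n + 2) * z) ^ ?n = K * z powr ?n"
    using z1 by (simp add: K_def power_mult_distrib powr_realpow)
  finally have "C * z powr (s - ?n) \<le> K"
    using z1 by (simp add: powr_diff field_simps)
  moreover have "K / C + 1 \<le> z powr (s - ?n)"
  proof -
    have K: "K / C + 1 > 0" using C by (auto simp: K_def intro!: add_nonneg_pos)
    then have "K / C + 1 = ((K / C + 1) powr (1 / (s - real ?n))) powr (s - ?n)"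
      using sn by (simp add: powr_powr)
    also have "\<dots> \<le> z powr (s - ?n)"
      using sn by (intro powr_mono2) (auto simp: z_def)
    finally show ?thesis .
  qed
  ultimately have "C * (K / C + 1) \<le> K"
    using C(1) by (meson mult_left_mono less_imp_le order_trans)
  moreover have "C * (K / C + 1) = K + C" using C(1) by (simp add: field_simps)
  ultimately show False using C(1) by simp
qed

text \<open>
  Refine a cover by balls of radius \<open>r\<close> to one by balls of radius \<open>\<rho> = r powr (1 / \<theta>)\<close>. Each ball costs
  at most a multiple of \<open>(r / \<rho>) ^ n\<close> new ones, while \<open>\<rho> powr (l * \<theta>) = r powr l \<le> R\<close> makes the lower
  bound with exponent \<open>s\<close> applicable at radius \<open>\<rho>\<close>. The exponent \<open>t\<close> is what remains in the worst case
  \<open>R = r powr l\<close>; for larger \<open>R\<close> the inequality only improves since \<open>s \<le> n\<close>.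
\<close>

lemma covering_exponent_trade:
  fixes X :: "(real ^ 'n) set"
  assumes s: "covering_exponent (l * \<theta>) X s" "s \<le> real CARD('n)"
    and l: "0 < l" "l < 1" and \<theta>: "0 < \<theta>" "\<theta> < 1"
    and t: "t = ((1 - l * \<theta>) * s - (1 - \<theta>) * real CARD('n)) / (\<theta> * (1 - l))" "0 \<le> t"
  shows "covering_exponent l X t"
proof -
  let ?n = "CARD('n)"
  obtain C where C: "C > 0" "\<And>r R x. 0 < r \<Longrightarrow> r \<le> r powr (l * \<theta>) \<Longrightarrow> r powr (l * \<theta>) \<le> R \<Longrightarrow> R < 1 \<Longrightarrow> x \<in> X
     \<Longrightarrow> ereal (C * (R / r) powr s) \<le> ereal_of_enat (covering_number X r (closed_ball_in X x R))"
    using s(1) unfolding covering_exponent_def by blast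
  define K where "K = (2 * real ?n + 2) ^ ?n"
  have K: "K > 0" by (simp add: K_def add_nonneg_pos)
  have "ereal (C / K * (R / r) powr t) \<le> ereal_of_enat (covering_number X r (closed_ball_in X x R))"
    if *: "0 < r" "r \<le> r powr l" "r powr l \<le> R" "R < 1" "x \<in> X" for r R x
  proof (cases "covering_number X r (closed_ball_in X x R)")
    case (enat m)
    have r: "r < 1" "0 < R" using * by linarith+
    define \<rho> where "\<rho> = r powr (1 / \<theta>)"
    have \<rho>: "0 < \<rho>" using * by (simp add: \<rho>_def)
    have "\<rho> \<le> r powr 1" unfolding \<rho>_def using * r \<theta> by (intro powr_mono') (auto simp: field_simps)
    then have \<rho>r: "\<rho> \<le> r" using * by simp
    have \<rho>l: "\<rho> powr (l * \<theta>) = r powr l" using \<theta> by (simp add: \<rho>_def powr_powr)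
    have C\<rho>: "ereal (C * (R / \<rho>) powr s) \<le> ereal_of_enat (covering_number X \<rho> (closed_ball_in X x R))"
      using * \<rho> \<rho>r \<rho>l by (intro C(2)) auto
    define k where "k = nat \<lfloor>K * (r / \<rho>) ^ ?n\<rfloor>"
    have k: "real k \<le> K * (r / \<rho>) ^ ?n"
      using K * \<rho> by (auto simp: k_def)
    have "covering_number X \<rho> (closed_ball_in X x R) \<le> enat (m * k)"
    proof (rule covering_number_mult[OF enat])
      fix y
      obtain i where i: "covering_number X \<rho> (closed_ball_in X y r) \<le> enat i"
        "real i \<le> ((2 * real ?n + 2) * (r / \<rho>)) ^ ?n"
        using covering_number_ball_le[OF \<rho> \<rho>r] .
      then have "i \<le> k" unfolding k_def K_def power_mult_distrib[symmetric]
        by (simp only: le_nat_floor)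
      with i(1) show "covering_number X \<rho> (closed_ball_in X y r) \<le> enat k"
        by (intro order_trans[OF i(1)]) simp
    qed (auto simp: closed_ball_in_def)
    with C\<rho> have "C * (R / \<rho>) powr s \<le> real (m * k)" by (rule le_of_enat_bound)
    then have "C * (R / \<rho>) powr s \<le> real m * real k" by simp
    also have "\<dots> \<le> real m * (K * (r / \<rho>) ^ ?n)" using k by (intro mult_left_mono) auto
    finally have "C * (R / \<rho>) powr s \<le> real m * K * (r / \<rho>) powr ?n"
      using * \<rho> by (simp add: powr_realpow mult.assoc)
    then have m: "C / K * ((R / \<rho>) powr s / (r / \<rho>) powr ?n) \<le> real m"
      using K * \<rho> by (simp add: field_simps)
    have "(R / r) powr t \<le> (R / \<rho>) powr s / (r / \<rho>) powr ?n"
    proof -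
      define a where "a = - ln r"
      define b where "b = - ln R"
      have ln\<rho>: "ln \<rho> = - a / \<theta>" using * by (simp add: \<rho>_def a_def ln_powr)
      have "ln (r powr l) \<le> ln R" using * r by (subst ln_le_cancel_iff) auto
      then have "b \<le> l * a" using * by (simp add: a_def b_def ln_powr)
      then have ba: "a * (1 - l) \<le> a - b" by (simp add: algebra_simps)
      define c where "c = (1 - \<theta>) * (real ?n - s) / \<theta>"
      have teq: "t = s - c / (1 - l)"
        using \<theta> l unfolding t c_def by (simp add: field_simps)
      \<comment> \<open>Here \<open>r powr l \<le> R\<close> enters, in the form \<open>a * (1 - l) \<le> a - b\<close>.\<close>
      have "0 \<le> c" using \<theta> s(2) unfolding c_def by (intro divide_nonneg_pos mult_nonneg_nonneg) auto
      moreover have "a \<le> (a - b) / (1 - l)" using l ba by (simp add: field_simps)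
      ultimately have "c * a \<le> c * ((a - b) / (1 - l))" by (intro mult_left_mono)
      moreover have "t * (a - b) = s * (a - b) - c * ((a - b) / (1 - l))"
        unfolding teq by (simp add: left_diff_distrib)
      ultimately have "t * (a - b) \<le> s * (a - b) - c * a" by linarith
      also have "\<dots> = s * (a / \<theta> - b) - ?n * (a / \<theta> - a)"
        using \<theta> unfolding c_def by (simp add: field_simps)
      finally have "exp (t * (a - b)) \<le> exp (s * (a / \<theta> - b) - ?n * (a / \<theta> - a))" by simp
      then show ?thesis
        using * r \<rho> by (simp add: powr_def ln_div exp_diff[symmetric] ln\<rho> a_def b_def algebra_simps)
    qed
    then have "C / K * (R / r) powr t \<le> C / K * ((R / \<rho>) powr s / (r / \<rho>) powr ?n)"
      using C(1) K by (intro mult_left_mono) auto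
    with m enat show ?thesis by simp
  qed simp
  moreover have "0 < C / K" using C(1) K by simp
  ultimately show ?thesis using t(2) unfolding covering_exponent_def by blast
qed

lemma scaled_lower_spectrum_le:
  assumes "0 < \<theta>" "\<theta> < 1" "\<And>s. covering_exponent \<theta> F s \<Longrightarrow> (1 - \<theta>) * s \<le> b"
    and "scaled_lower_spectrum \<theta> F = ereal y"
  shows "y \<le> b"
proof -
  have "lower_spectrum \<theta> F \<le> ereal (b / (1 - \<theta>))"
    unfolding lower_spectrum_eq_SUP using assms by (intro SUP_least) (auto simp: field_simps)
  then have "ereal (1 - \<theta>) * lower_spectrum \<theta> F \<le> ereal (1 - \<theta>) * ereal (b / (1 - \<theta>))"
    using assms by (intro ereal_mult_left_mono) auto
  then show ?thesis using assms by (simp add: scaled_lower_spectrum_def)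
qed

lemma covering_exponent_le_scaled:
  assumes "0 < \<theta>" "\<theta> < 1" "covering_exponent \<theta> F s" "scaled_lower_spectrum \<theta> F = ereal y"
  shows "(1 - \<theta>) * s \<le> y"
proof -
  have "ereal s \<le> lower_spectrum \<theta> F"
    unfolding lower_spectrum_eq_SUP using assms by (intro SUP_upper) auto
  then have "ereal (1 - \<theta>) * ereal s \<le> ereal (1 - \<theta>) * lower_spectrum \<theta> F"
    using assms by (intro ereal_mult_left_mono) auto
  then show ?thesis using assms by (simp add: scaled_lower_spectrum_def)
qed

lemma scaled_lower_spectrum_eqI:
  assumes "0 < \<theta>" "\<theta> < 1" "covering_exponent \<theta> F (y / (1 - \<theta>))"
    "\<And>s. covering_exponent \<theta> F s \<Longrightarrow> s \<le> y / (1 - \<theta>)"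
  shows "scaled_lower_spectrum \<theta> F = ereal y"
proof -
  have "lower_spectrum \<theta> F = ereal (y / (1 - \<theta>))"
    unfolding lower_spectrum_eq_SUP
    using assms by (intro antisym SUP_least SUP_upper) auto
  then show ?thesis using assms by (simp add: scaled_lower_spectrum_def)
qed

text \<open>
  Monotonicity holds because a smaller \<open>\<theta>\<close> constrains fewer pairs of scales. The growth condition is
  the bound \<open>s \<le> n\<close> for \<open>l = 1\<close>, and the trade of exponents between \<open>l * \<theta>\<close> and \<open>l\<close> for \<open>l < 1\<close>.
\<close>

lemma scaled_lower_spectrum_profile:
  fixes F :: "(real ^ 'n) set"
  assumes nonneg: "\<And>\<theta>. \<theta> \<in> {0<..1} \<Longrightarrow> 0 \<le> \<phi> \<theta>" and F: "F \<noteq> {}"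
    and eq: "\<And>\<theta>. \<theta> \<in> {0<..1} \<Longrightarrow> scaled_lower_spectrum \<theta> F = ereal (\<phi> \<theta>)"
  shows "spectrum_profile \<phi> (real CARD('n))"
proof
  show one: "\<phi> 1 = 0" using eq[of 1] by (simp add: scaled_lower_spectrum_def)
  show "antimono_on {0<..<1} (\<lambda>\<theta>. \<phi> \<theta> / (1 - \<theta>))"
  proof (rule monotone_onI)
    fix a b :: real assume ab: "a \<in> {0<..<1}" "b \<in> {0<..<1}" "a \<le> b"
    have "\<phi> b \<le> (1 - b) * (\<phi> a / (1 - a))"
    proof (rule scaled_lower_spectrum_le)
      fix s assume "covering_exponent b F s"
      then have "covering_exponent a F s" by (rule covering_exponent_mono) (use ab in auto)
      then have "(1 - a) * s \<le> \<phi> a" using ab by (intro covering_exponent_le_scaled[of _ F] eq) auto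
      then show "(1 - b) * s \<le> (1 - b) * (\<phi> a / (1 - a))"
        using ab by (intro mult_left_mono) (auto simp: field_simps)
    qed (use ab eq in auto)
    then show "\<phi> b / (1 - b) \<le> \<phi> a / (1 - a)" using ab by (simp add: field_simps)
  qed
  fix l \<theta> :: real assume l\<theta>: "l \<in> {0<..1}" "\<theta> \<in> {0<..1}"
  show "\<phi> (l * \<theta>) - \<theta> * \<phi> l \<le> (1 - \<theta>) * real CARD('n)"
  proof (cases "\<theta> = 1")
    case False
    then have \<theta>: "0 < \<theta>" "\<theta> < 1" using l\<theta> by auto
    have l: "0 < l" "l \<le> 1" using l\<theta> by auto
    have "l * \<theta> \<le> 1 * \<theta>" using l \<theta> by (intro mult_right_mono) auto
    then have l\<theta>1: "l * \<theta> < 1" using \<theta> by linarith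
    have l\<theta>0: "0 < l * \<theta>" using l \<theta> by simp
    have "\<phi> (l * \<theta>) \<le> \<theta> * \<phi> l + (1 - \<theta>) * real CARD('n)"
    proof (rule scaled_lower_spectrum_le[OF l\<theta>0 l\<theta>1])
      fix s assume s: "covering_exponent (l * \<theta>) F s"
      have sn: "s \<le> real CARD('n)" using covering_exponent_le_dim[OF s l\<theta>0 l\<theta>1 F] .
      show "(1 - l * \<theta>) * s \<le> \<theta> * \<phi> l + (1 - \<theta>) * real CARD('n)"
      proof (cases "l = 1")
        case True
        then show ?thesis using \<theta> sn one by simp
      next
        case False
        define t where "t = ((1 - l * \<theta>) * s - (1 - \<theta>) * real CARD('n)) / (\<theta> * (1 - l))"
        have l1: "l < 1" using False l by simp
        have "(1 - l) * t \<le> \<phi> l"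
        proof (cases "t \<ge> 0")
          case True
          then have "covering_exponent l F t"
            using covering_exponent_trade[OF s sn l(1) l1 \<theta> t_def] by simp
          then show ?thesis using l l1 by (intro covering_exponent_le_scaled[of _ F] eq) auto
        next
          case False
          then have "(1 - l) * t \<le> 0" using l1 by (simp add: mult_nonneg_nonpos)
          then show ?thesis using nonneg[of l] l\<theta> by simp
        qed
        then have "\<theta> * ((1 - l) * t) \<le> \<theta> * \<phi> l" using \<theta> by (intro mult_left_mono) auto
        moreover have "\<theta> * ((1 - l) * t) = (1 - l * \<theta>) * s - (1 - \<theta>) * real CARD('n)"
          using \<theta> l1 by (simp add: t_def)
        ultimately show ?thesis by simp
      qed
    qed (use l\<theta>0 l\<theta>1 eq in auto)
    then show ?thesis by simp
  qed simp
qed (use nonneg in auto)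

section \<open>Sufficiency: clusters near the corner of an orthant\<close>

text \<open>
  The cluster with index \<open>w\<close> belongs to the scale \<open>2 powr - w\<close>, but the cube containing it and its
  distance to the orthant are shrunk by the additional factor \<open>2 ^ (n + 3)\<close> so that a ball of radius \<open>2 powr - w\<close> about any of its points contains a large piece of
  the orthant in spite of the constants depending on the dimension \<open>n\<close>.
\<close>

abbreviation cluster_level :: "'n::finite itself \<Rightarrow> nat \<Rightarrow> nat" where
  "cluster_level _ w \<equiv> w + CARD('n) + 3"

definition cluster_digits :: "(real \<Rightarrow> real) \<Rightarrow> 'n::finite itself \<Rightarrow> nat \<Rightarrow> nat set" where
  "cluster_digits \<phi> _ w =
     floor_jumps (\<lambda>k. spectrum_profile.entropy \<phi> (real w) (real k) / real CARD('n)) (cluster_level TYPE('n) w)"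

definition cluster_corner :: "nat \<Rightarrow> real ^ 'n" where
  "cluster_corner w = (\<chi> i. - 3 * (1/2) ^ cluster_level TYPE('n) w)"

definition cluster :: "(real \<Rightarrow> real) \<Rightarrow> nat \<Rightarrow> (real ^ 'n) set" where
  "cluster \<phi> w = dyadic_shift (cluster_corner w) `
     {B. \<forall>i. finite (B i) \<and> B i \<subseteq> cluster_digits \<phi> TYPE('n) w}"

text \<open>
  The orthant is as thick as possible, and the clusters sit outside it near the origin, each at a
  distance from everything else that is comparable with the cube containing it. A ball about a cluster
  point thus sees the cluster alone as long as it is small, and a piece of the orthant otherwise.
\<close>

definition clustered_orthant :: "(real \<Rightarrow> real) \<Rightarrow> (real ^ 'n) set" where
  "clustered_orthant \<phi> = {x. \<forall>i. 0 \<le> x $ i} \<union> (\<Union>w\<in>{1..}. cluster \<phi> w)"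

lemma cluster_subset: "1 \<le> w \<Longrightarrow> cluster \<phi> w \<subseteq> clustered_orthant \<phi>"
  by (auto simp: clustered_orthant_def)

lemma cluster_digits_gt: "cluster_digits \<phi> TYPE('n::finite) w \<subseteq> {cluster_level TYPE('n) w<..}"
  by (auto simp: cluster_digits_def floor_jumps_def)

lemma cluster_coord:
  assumes "x \<in> (cluster \<phi> w :: (real ^ 'n) set)"
  shows "- 3 * (1/2) ^ cluster_level TYPE('n) w \<le> x $ i" "x $ i \<le> - 2 * (1/2) ^ cluster_level TYPE('n) w"
proof -
  obtain B where B: "x = dyadic_shift (cluster_corner w) B"
    "\<And>i. finite (B i)" "\<And>i. B i \<subseteq> cluster_digits \<phi> TYPE('n) w"
    using assms by (auto simp: cluster_def)
  have "dyadic_sum (B i) \<le> (1/2) ^ cluster_level TYPE('n) w"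
    using B(2,3)[of i] cluster_digits_gt by (intro dyadic_sum_le) blast+
  then show "- 3 * (1/2) ^ cluster_level TYPE('n) w \<le> x $ i" "x $ i \<le> - 2 * (1/2) ^ cluster_level TYPE('n) w"
    using dyadic_sum_nonneg[of "B i"] by (simp_all add: B(1) cluster_corner_def)
qed

lemma half_power_eq_powr: "(1/2 :: real) ^ m = 2 powr - real m"
  by (simp add: powr_minus powr_realpow power_divide field_simps)

lemma n_power_half_le: "real n * (1/2) ^ (m + n + 3) \<le> (1/2) ^ m / 8"
proof -
  have "real n * (1/2) ^ n \<le> 1"
    using of_nat_less_two_power[of n, where ?'a=real] by (simp add: power_divide field_simps)
  then have "(1/2) ^ m * (real n * (1/2) ^ n) \<le> (1/2) ^ m * 1" by (intro mult_left_mono) auto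
  then show ?thesis by (simp add: power_add field_simps)
qed

text \<open>
  In each coordinate the digits realise one \<open>n\<close>-th of the entropy; the increments of this quotient lie
  in \<open>[0, 1]\<close> by monotonicity and the Lipschitz bound.
\<close>

lemma cluster_digits_card:
  assumes "spectrum_profile \<phi> (real CARD('n::finite))" "1 \<le> w" "cluster_level TYPE('n) w \<le> j" "j \<le> k"
  shows "real (card (cluster_digits \<phi> TYPE('n) w \<inter> {j<..k})) =
    of_int (\<lfloor>spectrum_profile.entropy \<phi> w k / CARD('n)\<rfloor> - \<lfloor>spectrum_profile.entropy \<phi> w j / CARD('n)\<rfloor>)"
proof -
  interpret spectrum_profile \<phi> "real CARD('n)" by fact
  define g where "g k = entropy (real w) (real k) / real CARD('n)" for k :: nat
  have "g k \<le> g (Suc k) \<and> g (Suc k) \<le> g k + 1" if "cluster_level TYPE('n) w \<le> k" for k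
    using entropy_mono[of w k "Suc k"] entropy_lipschitz[of w k "Suc k"] that assms(2)
    by (auto simp: g_def field_simps)
  then have "int (card (floor_jumps g (cluster_level TYPE('n) w) \<inter> {j<..k})) = \<lfloor>g k\<rfloor> - \<lfloor>g j\<rfloor>"
    using assms(3,4) by (rule card_floor_jumps)
  then have "real_of_int (int (card (floor_jumps g (cluster_level TYPE('n) w) \<inter> {j<..k}))) = of_int (\<lfloor>g k\<rfloor> - \<lfloor>g j\<rfloor>)"
    by simp
  then show ?thesis unfolding cluster_digits_def g_def by simp
qed

text \<open>
  With \<open>r = 2 powr - u\<close> and \<open>R = 2 powr - v\<close>, the digits between \<open>v\<close> and \<open>u\<close> are free, apart from a
  bounded number at both ends. If the centre lies in the orthant, or in a cluster with
  \<open>v \<le> w\<close>, then a part of the orthant shows the exponent \<open>n\<close>. If it lies in a cluster with \<open>w < v\<close>,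
  then superadditivity bounds the entropy of the cluster between \<open>v\<close> and \<open>u\<close> from below by \<open>entropy v u\<close>.
\<close>

lemma clustered_orthant_covering_ge:
  fixes x :: "real ^ 'n"
  assumes prof: "spectrum_profile \<phi> (real CARD('n))" and \<theta>: "0 < \<theta>" "\<theta> < 1"
    and x: "x \<in> clustered_orthant \<phi>" and v: "0 < v" "v \<le> \<theta> * u"
    and large: "real CARD('n) + 8 \<le> u - v"
  shows "\<exists>a. enat (2 ^ (CARD('n) * a)) \<le> covering_number (clustered_orthant \<phi>) (2 powr - u)
      (closed_ball_in (clustered_orthant \<phi>) x (2 powr - v)) \<and>
    \<phi> \<theta> / (1 - \<theta>) * (u - v) - real CARD('n) * (real CARD('n) + 8) \<le> real (CARD('n) * a)"
proof -
  interpret spectrum_profile \<phi> "real CARD('n)" by fact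
  let ?n = "real CARD('n)" and ?X = "clustered_orthant \<phi> :: (real ^ 'n) set"
  let ?D = "\<phi> \<theta> / (1 - \<theta>)"
  define j where "j = nat \<lceil>v\<rceil> + CARD('n) + 3"
  \<comment> \<open>The offset \<open>2\<close> makes the separation \<open>2 powr - k\<close> at least \<open>4 * r\<close>.\<close>
  define k where "k = nat \<lfloor>u\<rfloor> - 2"
  have j: "v + ?n + 3 \<le> real j" "real j \<le> v + ?n + 4"
    using v by (auto simp: j_def) linarith+
  have "2 \<le> nat \<lfloor>u\<rfloor>" using large v by linarith
  then have k: "real k \<le> u - 2" "u - 3 \<le> real k"
    using large v by (auto simp: k_def of_nat_diff) linarith+
  have jk: "j \<le> k" using j k large by linarith
  have jR: "?n * (1/2) ^ j \<le> 2 powr - v / 8"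
  proof -
    have "?n * (1/2) ^ j \<le> (1/2) ^ (nat \<lceil>v\<rceil>) / 8"
      unfolding j_def by (rule n_power_half_le)
    also have "(1/2) ^ (nat \<lceil>v\<rceil>) \<le> 2 powr - v"
      unfolding half_power_eq_powr using real_nat_ceiling_ge[of v] by (intro powr_mono) auto
    finally show ?thesis by simp
  qed
  have jR2: "?n * (1/2) ^ j \<le> 2 powr - v / 2" using jR powr_ge_zero[of 2 "- v"] by linarith
  have kr: "2 * 2 powr - u < (1/2) ^ k"
  proof -
    have "2 * 2 powr - u = 2 powr (1 - u)" by (simp add: powr_diff powr_minus field_simps)
    also have "\<dots> < 2 powr - real k" using k by (intro powr_less_mono) auto
    finally show ?thesis by (simp add: half_power_eq_powr)
  qed
  have D: "?D \<le> ?n" "0 \<le> ?D" using exponent_le[OF \<theta>] nonneg[of \<theta>] \<theta> by auto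
  have full: ?thesis if p: "\<forall>i. 0 \<le> p $ i" "dist x p \<le> 2 powr - v / 2" for p
  proof (intro exI conjI)
    show "enat (2 ^ (CARD('n) * card {j<..k})) \<le> covering_number ?X (2 powr - u)
      (closed_ball_in ?X x (2 powr - v))"
    proof (rule covering_number_ge_dyadic)
      show "dyadic_shift p B \<in> ?X" for B
        using p(1) by (auto simp: clustered_orthant_def intro!: add_nonneg_nonneg dyadic_sum_nonneg)
    qed (use p jR2 kr in auto)
    have "?D * (u - v) \<le> ?n * (u - v)" using D large by (intro mult_right_mono) auto
    also have "\<dots> \<le> ?n * ((real k - real j) + (?n + 8))"
      using j k by (intro mult_left_mono) auto
    finally show "?D * (u - v) - ?n * (?n + 8) \<le> real (CARD('n) * card {j<..k})"
      using jk by (simp add: of_nat_diff algebra_simps)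
  qed
  consider "\<forall>i. 0 \<le> x $ i" | w where "1 \<le> w" "x \<in> cluster \<phi> w" "v \<le> w"
    | w where "1 \<le> w" "x \<in> cluster \<phi> w" "w < v"
    using x by (fastforce simp: clustered_orthant_def not_le)
  then show ?thesis
  proof cases
    case 1
    then show ?thesis by (intro full[of x]) auto
  next
    case 2
    \<comment> \<open>The origin, a corner of the orthant, is near enough.\<close>
    have "dist x 0 \<le> ?n * (3 * (1/2) ^ cluster_level TYPE('n) w)"
    proof (rule dist_le_card_mult)
      fix i
      have "0 \<le> (1/2 :: real) ^ cluster_level TYPE('n) w" by simp
      then show "\<bar>x $ i - 0 $ i\<bar> \<le> 3 * (1/2) ^ cluster_level TYPE('n) w"
        using cluster_coord[OF 2(2), of i] by simp
    qed
    also have "\<dots> \<le> 3 * ((1/2) ^ w / 8)" using n_power_half_le[of "CARD('n)" w] by simp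
    also have "(1/2) ^ w \<le> 2 powr - v" unfolding half_power_eq_powr using 2 by (intro powr_mono) auto
    finally have "dist x 0 \<le> 2 powr - v / 2" using powr_ge_zero[of 2 "- v"] by linarith
    then show ?thesis by (intro full[of 0]) simp_all
  next
    case 3
    obtain B where B: "x = dyadic_shift (cluster_corner w) B"
      "\<And>i. finite (B i)" "\<And>i. B i \<subseteq> cluster_digits \<phi> TYPE('n) w"
      using 3 by (auto simp: cluster_def)
    let ?A = "cluster_digits \<phi> TYPE('n) w \<inter> {j<..k}"
    \<comment> \<open>Truncating the digits of \<open>x\<close> after \<open>j\<close> leaves the later ones free.\<close>
    let ?p = "dyadic_shift (cluster_corner w) (\<lambda>i. B i \<inter> {..j}) :: real ^ 'n"
    have wj: "cluster_level TYPE('n) w \<le> j" using 3 j by linarith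
    show ?thesis
    proof (intro exI conjI)
      show "enat (2 ^ (CARD('n) * card ?A)) \<le> covering_number ?X (2 powr - u)
        (closed_ball_in ?X x (2 powr - v))"
      proof (rule covering_number_ge_dyadic)
        fix B' :: "'n \<Rightarrow> nat set" assume B': "\<And>i. B' i \<subseteq> ?A"
        have fin: "finite (B' i)" for i using B'[of i] by (auto intro: finite_subset)
        have "dyadic_shift ?p B' = dyadic_shift (cluster_corner w) (\<lambda>i. B i \<inter> {..j} \<union> B' i)"
        proof (subst vec_eq_iff, rule allI)
          fix i
          have "dyadic_sum (B i \<inter> {..j} \<union> B' i) = dyadic_sum (B i \<inter> {..j}) + dyadic_sum (B' i)"
            by (rule dyadic_sum_Un) (use fin B' B(2) in force)+
          then show "dyadic_shift ?p B' $ i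
              = dyadic_shift (cluster_corner w) (\<lambda>i. B i \<inter> {..j} \<union> B' i) $ i" by simp
        qed
        also have "\<dots> \<in> cluster \<phi> w"
          unfolding cluster_def by (rule imageI) (use fin B(2,3) B' in auto)
        finally show "dyadic_shift ?p B' \<in> ?X"
          using cluster_subset[OF 3(1)] by blast
      next
        have "dist x ?p \<le> ?n * (1/2) ^ j"
        proof (rule dist_le_card_mult)
          fix i
          have "dyadic_sum (B i) = dyadic_sum (B i \<inter> {..j}) + dyadic_sum (B i \<inter> {j<..})"
            using B(2)[of i] by (subst dyadic_sum_Un[symmetric]) (auto intro: arg_cong[where f=dyadic_sum])
          moreover have "dyadic_sum (B i \<inter> {j<..}) \<le> (1/2) ^ j"
            using B(2)[of i] by (intro dyadic_sum_le) auto
          ultimately show "\<bar>x $ i - ?p $ i\<bar> \<le> (1/2) ^ j"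
            using dyadic_sum_nonneg[of "B i \<inter> {j<..}"] by (simp add: B(1))
        qed
        then show "dist x ?p \<le> 2 powr - v / 2" using jR2 by linarith
      qed (use jR2 kr in auto)
      have uv: "v \<le> u" using large by simp
      have w0: "0 < real w" using 3 by simp
      have "?D * (u - v) \<le> entropy v u" using \<theta> v by (intro entropy_ge_exponent) auto
      also have "\<dots> \<le> entropy w u - entropy w v"
        using entropy_superadditive[of w v u] w0 3 uv by simp
      also have "\<dots> \<le> (entropy w k + ?n * (u - k)) - entropy w v"
        using entropy_lipschitz[of w k u] w0 wj jk k by simp
      also have "\<dots> \<le> (entropy w k + ?n * (u - k)) - (entropy w j - ?n * (j - v))"
        using entropy_lipschitz[of w v j] w0 3 j by simp
      also have "\<dots> = entropy w k - entropy w j + ?n * ((u - k) + (j - v))"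
        by (simp add: algebra_simps)
      also have "\<dots> \<le> entropy w k - entropy w j + ?n * (?n + 7)"
        using j k by (intro add_left_mono mult_left_mono) auto
      also have "entropy w k - entropy w j = ?n * (entropy w k / ?n - entropy w j / ?n)"
        by (simp add: field_simps)
      also have "\<dots> \<le> ?n * (real (card ?A) + 1)"
        unfolding cluster_digits_card[OF prof 3(1) wj jk] by (intro mult_left_mono) linarith+
      finally show "?D * (u - v) - ?n * (?n + 8) \<le> real (CARD('n) * card ?A)"
        by (simp add: algebra_simps)
    qed
  qed
qed

lemma clustered_orthant_exponent:
  fixes \<phi> :: "real \<Rightarrow> real"
  assumes prof: "spectrum_profile \<phi> (real CARD('n::finite))" and \<theta>: "0 < \<theta>" "\<theta> < 1"
  shows "covering_exponent \<theta> (clustered_orthant \<phi> :: (real ^ 'n) set) (\<phi> \<theta> / (1 - \<theta>))"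
proof -
  interpret spectrum_profile \<phi> "real CARD('n)" by fact
  let ?n = "real CARD('n)" and ?X = "clustered_orthant \<phi> :: (real ^ 'n) set"
  define D where "D = \<phi> \<theta> / (1 - \<theta>)"
  define L where "L = ?n * (?n + 8)"
  have D: "0 \<le> D" "D \<le> ?n" using exponent_le[OF \<theta>] nonneg[of \<theta>] \<theta> by (auto simp: D_def)
  have "ereal (2 powr - L * (R / r) powr D) \<le> ereal_of_enat (covering_number ?X r (closed_ball_in ?X x R))"
    if *: "0 < r" "r \<le> r powr \<theta>" "r powr \<theta> \<le> R" "R < 1" and x: "x \<in> ?X" for r R x
  proof -
    have R: "0 < R" using * by linarith
    define u where "u = - log 2 r"
    define v where "v = - log 2 R"
    have r_eq: "r = 2 powr - u" and R_eq: "R = 2 powr - v" using * R by (simp_all add: u_def v_def)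
    have v: "0 < v" using * R by (simp add: v_def)
    have "log 2 (r powr \<theta>) \<le> log 2 R" using * by (subst log_le_cancel_iff) auto
    then have vu: "v \<le> \<theta> * u" using * by (simp add: u_def v_def log_powr)
    have lhs: "2 powr - L * (R / r) powr D = 2 powr (D * (u - v) - L)"
      by (simp add: r_eq R_eq powr_diff[symmetric] powr_powr powr_add[symmetric] algebra_simps)
    show ?thesis
    proof (cases "?n + 8 \<le> u - v")
      case True
      obtain a where a: "enat (2 ^ (CARD('n) * a)) \<le> covering_number ?X r (closed_ball_in ?X x R)"
        "D * (u - v) - L \<le> real (CARD('n) * a)"
        using clustered_orthant_covering_ge[OF prof \<theta> x v vu True] unfolding r_eq R_eq D_def L_def by blast
      have "2 powr (D * (u - v) - L) \<le> 2 powr real (CARD('n) * a)"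
        using a(2) by (intro powr_mono) auto
      also have "\<dots> = real (2 ^ (CARD('n) * a))" by (simp only: powr_realpow of_nat_power of_nat_numeral zero_less_numeral)
      finally have "ereal (2 powr (D * (u - v) - L)) \<le> ereal_of_enat (enat (2 ^ (CARD('n) * a)))"
        by simp
      also have "\<dots> \<le> ereal_of_enat (covering_number ?X r (closed_ball_in ?X x R))"
        using a(1) by (simp only: ereal_of_enat_le_iff)
      finally show ?thesis unfolding lhs .
    next
      case False
      have "D * (u - v) \<le> ?n * (?n + 8)"
      proof (cases "u - v \<ge> 0")
        case True
        then show ?thesis using D False by (intro mult_mono) auto
      next
        case False
        then have "D * (u - v) \<le> 0" using D by (simp add: mult_nonneg_nonpos)
        then show ?thesis by (smt (verit) mult_nonneg_nonneg of_nat_0_le_iff)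
      qed
      then have "2 powr (D * (u - v) - L) \<le> 2 powr 0"
        by (intro powr_mono) (auto simp: L_def)
      then have "ereal (2 powr (D * (u - v) - L)) \<le> ereal_of_enat (enat (card {x}))" by simp
      also have "enat (card {x}) \<le> covering_number ?X r (closed_ball_in ?X x R)"
        using x R by (intro card_le_covering_number) (auto simp: closed_ball_in_def)
      then have "ereal_of_enat (enat (card {x})) \<le> ereal_of_enat (covering_number ?X r (closed_ball_in ?X x R))"
        by (simp only: ereal_of_enat_le_iff)
      finally show ?thesis unfolding lhs .
    qed
  qed
  then show ?thesis using D(1) unfolding covering_exponent_def D_def[symmetric]
    by (intro conjI exI[of _ "2 powr - L"] allI impI ballI) simp_all
qed

text \<open>
  The orthant and the clusters with their different indices occupy disjoint ranges in every
  coordinate, so a single coordinate suffices to separate them.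
\<close>

lemma cluster_isolated:
  fixes x :: "real ^ 'n"
  assumes "x \<in> clustered_orthant \<phi>" "1 \<le> w"
    "dist (cluster_corner w) x \<le> (1/2) ^ (cluster_level TYPE('n) w + 2)"
  shows "x \<in> cluster \<phi> w"
proof -
  let ?N = "\<lambda>w. cluster_level TYPE('n) w"
  define h where "h = (1/2 :: real) ^ ?N w"
  have h: "0 < h" by (simp add: h_def)
  fix i :: 'n
  have "(1/2) ^ (?N w + 2) = h / 4" unfolding h_def power_add[of _ "?N w"] by (simp add: power2_eq_square)
  then have "\<bar>(cluster_corner w - x) $ i\<bar> \<le> h / 4"
    using component_le_norm_cart[of "cluster_corner w - x" i] assms(3) by (simp only: dist_norm)
  then have xi: "- (13/4) * h \<le> x $ i" "x $ i \<le> - (11/4) * h"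
    unfolding abs_le_iff by (simp_all add: cluster_corner_def h_def[symmetric])
  consider "0 \<le> x $ i" | w' where "x \<in> cluster \<phi> w'"
    using assms(1) by (auto simp: clustered_orthant_def)
  then show ?thesis
  proof cases
    case 1
    then show ?thesis using xi h by simp
  next
    case 2
    note c = cluster_coord[OF 2, of i]
    consider "w' < w" | "w' = w" | "w < w'" by linarith
    then show ?thesis
    proof cases
      case 1
      have "2 * h = (1/2) ^ (?N w - 1)" by (simp add: h_def power_eq_if)
      also have "\<dots> \<le> (1/2) ^ ?N w'" using 1 by (intro power_decreasing) auto
      finally show ?thesis using c(2) xi h by linarith
    next
      case 3
      have "(1/2) ^ ?N w' \<le> (1/2 :: real) ^ Suc (?N w)" using 3 by (intro power_decreasing) auto
      also have "\<dots> = h / 2" by (simp only: h_def power_Suc)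
      finally have "(1/2) ^ ?N w' \<le> h / 2" .
      then show ?thesis using c(1) xi h by linarith
    qed (use 2 in simp)
  qed
qed

text \<open>
  The points of a cluster with digits up to \<open>k\<close> only, where \<open>k\<close> exceeds \<open>u\<close> by a constant, are centres of
  a cover.
\<close>

lemma cluster_covering_le:
  fixes \<phi> :: "real \<Rightarrow> real" and w :: nat
  assumes prof: "spectrum_profile \<phi> (real CARD('n::finite))" and w: "1 \<le> w"
    and u: "real (cluster_level TYPE('n) w) \<le> u"
  shows "\<exists>m. covering_number (clustered_orthant \<phi> :: (real ^ 'n) set) (2 powr - u)
      (closed_ball_in (clustered_orthant \<phi>) (cluster_corner w) ((1/2) ^ (cluster_level TYPE('n) w + 2))) \<le> enat m \<and>
    real m \<le> 2 powr (u * \<phi> (w / u) + real CARD('n) * (real CARD('n) + 5))"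
proof -
  interpret spectrum_profile \<phi> "real CARD('n)" by fact
  let ?n = "real CARD('n)" and ?X = "clustered_orthant \<phi> :: (real ^ 'n) set"
  let ?N = "cluster_level TYPE('n) w" and ?A = "cluster_digits \<phi> TYPE('n) w"
  let ?c = "cluster_corner w :: real ^ 'n"
  define k where "k = nat \<lceil>u\<rceil> + CARD('n) + 3"
  have u0: "0 < u" using u by linarith
  have k: "u \<le> real k" "real k \<le> u + ?n + 4" using u0 by (auto simp: k_def) linarith+
  have Nk: "?N \<le> k" using u k by linarith
  have kr: "?n * (1/2) ^ k \<le> 2 powr - u"
  proof -
    have "?n * (1/2) ^ k \<le> (1/2) ^ (nat \<lceil>u\<rceil>) / 8"
      unfolding k_def by (rule n_power_half_le)
    also have "\<dots> \<le> (1/2) ^ (nat \<lceil>u\<rceil>)" by simp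
    also have "(1/2) ^ (nat \<lceil>u\<rceil>) \<le> 2 powr - u"
      unfolding half_power_eq_powr using real_nat_ceiling_ge[of u] by (intro powr_mono) auto
    finally show ?thesis .
  qed
  let ?Ak = "?A \<inter> {?N<..k}"
  let ?P = "dyadic_shift ?c ` PiE UNIV (\<lambda>_. Pow ?Ak)"
  have fin: "finite (PiE (UNIV :: 'n set) (\<lambda>_. Pow ?Ak))" by (intro finite_PiE) auto
  have "covering_number ?X (2 powr - u) (closed_ball_in ?X ?c ((1/2) ^ (?N + 2))) \<le> enat (card ?P)"
  proof (rule covering_number_le_card)
    show "finite ?P" using fin by simp
    have "?P \<subseteq> cluster \<phi> w"
    proof -
      have "finite (B i) \<and> B i \<subseteq> ?A" if "B \<in> PiE (UNIV :: 'n set) (\<lambda>_. Pow ?Ak)" for B i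
      proof -
        have "B i \<subseteq> ?Ak" using that by (auto simp: PiE_UNIV_domain)
        then show ?thesis by (auto intro: finite_subset[of _ ?Ak])
      qed
      then show ?thesis unfolding cluster_def by (intro image_mono) blast
    qed
    then show "?P \<subseteq> ?X" using cluster_subset[OF w] by (rule subset_trans)
    fix y assume "y \<in> closed_ball_in ?X ?c ((1/2) ^ (?N + 2))"
    then have "y \<in> cluster \<phi> w"
      using w by (intro cluster_isolated) (auto simp: closed_ball_in_def)
    then obtain B where B: "y = dyadic_shift ?c B" "\<And>i. finite (B i)" "\<And>i. B i \<subseteq> ?A"
      by (auto simp: cluster_def)
    have "dist (dyadic_shift ?c (\<lambda>i. B i \<inter> {..k})) y \<le> ?n * (1/2) ^ k"
    proof (rule dist_le_card_mult)
      fix i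
      have "dyadic_sum (B i) = dyadic_sum (B i \<inter> {..k}) + dyadic_sum (B i \<inter> {k<..})"
        using B(2)[of i] by (subst dyadic_sum_Un[symmetric]) (auto intro: arg_cong[where f=dyadic_sum])
      moreover have "dyadic_sum (B i \<inter> {k<..}) \<le> (1/2) ^ k"
        using B(2)[of i] by (intro dyadic_sum_le) auto
      ultimately show "\<bar>dyadic_shift ?c (\<lambda>i. B i \<inter> {..k}) $ i - y $ i\<bar> \<le> (1/2) ^ k"
        using dyadic_sum_nonneg[of "B i \<inter> {k<..}"] by (simp add: B(1))
    qed
    then have "dist (dyadic_shift ?c (\<lambda>i. B i \<inter> {..k})) y \<le> 2 powr - u" using kr by linarith
    moreover have "(\<lambda>i. B i \<inter> {..k}) \<in> PiE UNIV (\<lambda>_. Pow ?Ak)"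
      using B(3) cluster_digits_gt[where ?'n='n and \<phi>=\<phi> and w=w] by (fastforce simp: PiE_UNIV_domain)
    ultimately show "\<exists>p\<in>?P. dist p y \<le> 2 powr - u" by (rule rev_bexI[OF imageI, rotated])
  qed (auto simp: closed_ball_in_def)
  moreover have "real (card ?P) \<le> 2 powr (u * \<phi> (w / u) + ?n * (?n + 5))"
  proof -
    have "card ?P \<le> card (PiE (UNIV :: 'n set) (\<lambda>_. Pow ?Ak))" by (rule card_image_le[OF fin])
    also have "\<dots> = 2 ^ (CARD('n) * card ?Ak)"
      by (rule card_PiE_Pow) simp
    finally have "real (card ?P) \<le> real (2 ^ (CARD('n) * card ?Ak))" by (simp only: of_nat_le_iff)
    also have "\<dots> = 2 powr (?n * real (card ?Ak))"
      by (simp only: powr_realpow of_nat_power of_nat_numeral zero_less_numeral flip: of_nat_mult)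
    also have "\<dots> \<le> 2 powr (u * \<phi> (w / u) + ?n * (?n + 5))"
    proof (rule powr_mono)
      have w0: "0 < real w" using w by simp
      have "?n * real (card ?Ak) \<le> ?n * (entropy w k / ?n - entropy w ?N / ?n + 1)"
        unfolding cluster_digits_card[OF prof w order_refl Nk] by (intro mult_left_mono) linarith+
      also have "\<dots> = entropy w k - entropy w ?N + ?n" by (simp add: field_simps)
      also have "\<dots> \<le> entropy w k + ?n" using entropy_nonneg[of w ?N] w0 by simp
      also have "\<dots> \<le> entropy w u + ?n * (k - u) + ?n"
        using entropy_lipschitz[of w u k] w0 u k by simp
      also have "\<dots> \<le> entropy w u + ?n * (?n + 4) + ?n"
        using k by (intro add_mono mult_left_mono) auto
      finally show "?n * real (card ?Ak) \<le> u * \<phi> (w / u) + ?n * (?n + 5)"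
        by (simp add: entropy_def algebra_simps)
    qed simp
    finally show ?thesis .
  qed
  ultimately show ?thesis by blast
qed

text \<open>
  Test an exponent on the whole cluster with index \<open>w\<close> at radius \<open>R = 2 powr - v\<close>, where \<open>v\<close> exceeds \<open>w\<close> by
  a constant, and at the smallest admissible resolution \<open>r = R powr (1 / \<theta>)\<close>. The growth condition
  compares \<open>\<phi> (w / u)\<close> with \<open>\<phi> \<theta>\<close>, since \<open>w / u\<close> and \<open>\<theta> = v / u\<close> differ by the factor \<open>w / v\<close> only. The
  resulting excess is bounded while \<open>w\<close> tends to infinity.
\<close>

lemma clustered_orthant_exponent_le:
  fixes \<phi> :: "real \<Rightarrow> real"
  assumes prof: "spectrum_profile \<phi> (real CARD('n::finite))" and \<theta>: "0 < \<theta>" "\<theta> < 1"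
    and s: "covering_exponent \<theta> (clustered_orthant \<phi> :: (real ^ 'n) set) s"
  shows "s \<le> \<phi> \<theta> / (1 - \<theta>)"
proof (rule ccontr)
  interpret spectrum_profile \<phi> "real CARD('n)" by fact
  let ?n = "real CARD('n)" and ?X = "clustered_orthant \<phi> :: (real ^ 'n) set"
  assume "\<not> s \<le> \<phi> \<theta> / (1 - \<theta>)"
  then have \<epsilon>: "0 < (1 - \<theta>) * s - \<phi> \<theta>" (is "0 < ?\<epsilon>") using \<theta> by (simp add: field_simps)
  obtain C where C: "C > 0" "\<And>r R x. 0 < r \<Longrightarrow> r \<le> r powr \<theta> \<Longrightarrow> r powr \<theta> \<le> R \<Longrightarrow> R < 1 \<Longrightarrow> x \<in> ?X
     \<Longrightarrow> ereal (C * (R / r) powr s) \<le> ereal_of_enat (covering_number ?X r (closed_ball_in ?X x R))"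
    using s unfolding covering_exponent_def by blast
  define K where "K = ?n * (?n + 5) / \<theta> + ?n * (?n + 5) - log 2 C"
  have bound: "real w * ?\<epsilon> \<le> K" if w: "1 \<le> w" for w :: nat
  proof -
    let ?N = "cluster_level TYPE('n) w"
    define v where "v = real ?N + 2"
    define u where "u = v / \<theta>"
    have v: "0 < v" "real w \<le> v" by (auto simp: v_def)
    have u: "0 < u" "\<theta> * u = v" using \<theta> v by (auto simp: u_def)
    have vu: "v \<le> u" using \<theta> v by (simp add: u_def field_simps)
    obtain m where m: "covering_number ?X (2 powr - u) (closed_ball_in ?X (cluster_corner w) ((1/2) ^ (?N + 2))) \<le> enat m"
      "real m \<le> 2 powr (u * \<phi> (w / u) + ?n * (?n + 5))"
      using cluster_covering_le[OF prof w, of u] vu by (auto simp: v_def)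
    have R: "(1/2 :: real) ^ (?N + 2) = 2 powr - v"
      by (simp add: half_power_eq_powr v_def)
    have "dyadic_shift (cluster_corner w :: real ^ 'n) (\<lambda>_. {}) \<in> cluster \<phi> w"
      unfolding cluster_def by (rule imageI) simp
    moreover have "dyadic_shift (cluster_corner w :: real ^ 'n) (\<lambda>_. {}) = cluster_corner w"
      by (simp add: vec_eq_iff dyadic_sum_def)
    moreover have "cluster \<phi> w \<subseteq> ?X" using w by (rule cluster_subset)
    ultimately have cX: "cluster_corner w \<in> ?X" by auto
    have rt: "(2 powr - u) powr \<theta> = 2 powr - v" using u by (simp add: powr_powr mult.commute)
    have "ereal (C * (2 powr - v / 2 powr - u) powr s)
        \<le> ereal_of_enat (covering_number ?X (2 powr - u) (closed_ball_in ?X (cluster_corner w) (2 powr - v)))"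
    proof (rule C(2))
      show "2 powr - v < (1::real)" using v powr_less_mono[of "- v" 0 2] by simp
    qed (use rt vu cX in auto)
    then have "C * (2 powr - v / 2 powr - u) powr s \<le> real m"
      by (rule le_of_enat_bound) (use m(1) R in simp)
    also have "\<dots> \<le> 2 powr (u * \<phi> (w / u) + ?n * (?n + 5))" by (rule m)
    also have "C * (2 powr - v / 2 powr - u) powr s = 2 powr (log 2 C + s * (u - v))"
      using C(1) by (simp add: powr_diff[symmetric] powr_powr powr_add mult.commute)
    finally have main: "log 2 C + s * (u - v) \<le> u * \<phi> (w / u) + ?n * (?n + 5)" by simp
    have "\<phi> (\<theta> * (w / v)) - w / v * \<phi> \<theta> \<le> (1 - w / v) * ?n"
      using \<theta> v w by (intro growth) auto
    moreover have "\<theta> * (w / v) = w / u" using \<theta> v by (simp add: u_def)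
    moreover have "w / v * \<phi> \<theta> \<le> 1 * \<phi> \<theta>" using \<theta> v w nonneg[of \<theta>] by (intro mult_right_mono) auto
    ultimately have "\<phi> (w / u) \<le> \<phi> \<theta> + (1 - w / v) * ?n" by simp
    then have "u * \<phi> (w / u) \<le> u * (\<phi> \<theta> + (1 - w / v) * ?n)" using u by (intro mult_left_mono) auto
    also have "\<dots> = u * \<phi> \<theta> + ?n * ((v - w) / \<theta>)" using \<theta> v by (simp add: u_def field_simps)
    also have "v - w = ?n + 5" by (simp add: v_def)
    finally have "s * (u - v) - u * \<phi> \<theta> \<le> K" using main by (simp add: K_def)
    moreover have "s * (u - v) - u * \<phi> \<theta> = u * ?\<epsilon>" using u(2)[symmetric] by (simp add: algebra_simps)
    moreover have "real w * ?\<epsilon> \<le> u * ?\<epsilon>" using \<epsilon> v vu by (intro mult_right_mono) auto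
    ultimately show ?thesis by linarith
  qed
  obtain w :: nat where "K / ?\<epsilon> < real w" using reals_Archimedean2 by blast
  then have "K < real (Suc w) * ?\<epsilon>" using \<epsilon> by (simp add: field_simps)
  then show False using bound[of "Suc w"] by simp
qed

section \<open>The characterisation\<close>

theorem corollaryD:
  fixes \<phi> :: "real \<Rightarrow> real"
  assumes "\<phi> \<in> {0<..1} \<rightarrow> {0..real CARD('n::finite)}"
  shows "(\<exists>F :: (real ^ 'n) set. F \<noteq> {} \<and>
            (\<forall>\<theta>\<in>{0<..1}. scaled_lower_spectrum \<theta> F = ereal (\<phi> \<theta>))) \<longleftrightarrow>
         \<phi> 1 = 0 \<and>
         antimono_on {0<..<1} (\<lambda>\<theta>. \<phi> \<theta> / (1 - \<theta>)) \<and>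
         (\<forall>l\<in>{0<..1}. \<forall>\<theta>\<in>{0<..1}.
            \<phi> (l * \<theta>) - \<theta> * \<phi> l \<le> (1 - \<theta>) * real CARD('n))"
    (is "?L \<longleftrightarrow> ?R")
proof -
  have nonneg: "0 \<le> \<phi> \<theta>" if "\<theta> \<in> {0<..1}" for \<theta>
    using funcset_mem[OF assms that] by simp
  have "?R \<longleftrightarrow> spectrum_profile \<phi> (real CARD('n))"
    unfolding spectrum_profile_def using nonneg by blast
  moreover have "?L \<longleftrightarrow> spectrum_profile \<phi> (real CARD('n))"
  proof
    assume ?L
    then obtain F :: "(real ^ 'n) set" where "F \<noteq> {}"
      "\<And>\<theta>. \<theta> \<in> {0<..1} \<Longrightarrow> scaled_lower_spectrum \<theta> F = ereal (\<phi> \<theta>)" by blast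
    then show "spectrum_profile \<phi> (real CARD('n))"
      using nonneg by (intro scaled_lower_spectrum_profile)
  next
    assume prof: "spectrum_profile \<phi> (real CARD('n))"
    have "scaled_lower_spectrum \<theta> (clustered_orthant \<phi> :: (real ^ 'n) set) = ereal (\<phi> \<theta>)"
      if "\<theta> \<in> {0<..1}" for \<theta>
    proof (cases "\<theta> = 1")
      case True
      then show ?thesis using spectrum_profile.at_1[OF prof] by (simp add: scaled_lower_spectrum_def)
    next
      case False
      then have \<theta>: "0 < \<theta>" "\<theta> < 1" using that by auto
      show ?thesis
        using clustered_orthant_exponent[OF prof \<theta>] clustered_orthant_exponent_le[OF prof \<theta>]
        by (intro scaled_lower_spectrum_eqI \<theta>)
    qed
    moreover have "(0 :: real ^ 'n) \<in> clustered_orthant \<phi>" by (simp add: clustered_orthant_def)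
    ultimately show ?L by blast
  qed
  ultimately show ?thesis by simp
qed

end
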